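(* Let $\boldsymbol\theta=(\theta_1,\dots,\theta_{N_P})\in\mathbb{R}^{N_P}$ be the control vector, and let $\mathbf{w}_0,\mathbf{w}_1,\dots,\mathbf{w}_{N_T}\in\mathbb{R}^{2N}$ be the numerical approximation (depending on $\boldsymbol\theta$ through the scheme, with $\mathbf{w}_0$ fixed and independent of $\boldsymbol\theta$) to the real-valued form $\frac{d}{dt}\mathbf{w}(t)=A(t;\boldsymbol\theta)\mathbf{w}(t)$ of Schrödinger's equation, satisfying the timestepping rule $$\mathbf{w}_{n+1}-L_{n+1,q}\mathbf{w}_{n+1}=\mathbf{w}_n+R_{n,p}\mathbf{w}_n,\qquad n=0,1,\dots,N_T-1,$$ where $L_{n,q}=L_{n,q}(\boldsymbol\theta)$ and $R_{n,p}=R_{n,p}(\boldsymbol\theta)$ are the Hermite Runge-Kutta matrices defined in the context. Let the discrete cost function be $$\mathcal{J}(\boldsymbol\theta)=\sum_{n=0}^{N_T}\mathfrak{j}_n(\mathbf{w}_n),$$ where each $\mathfrak{j}_n:\mathbb{R}^{2N}\to\mathbb{R}$ is differentiable and depends on $\boldsymbol\theta$ only through $\mathbf{w}_n=\mathbf{w}_n(\boldsymbol\theta)$. Let $\boldsymbol\lambda_1,\dots,\boldsymbol\lambda_{N_T}\in\mathbb{R}^{2N}$ satisfy the terminal condition and adjoint equations $$\boldsymbol\lambda_{N_T}-(L_{N_T,q})^T\boldsymbol\lambda_{N_T}=-\left(\frac{\partial \mathfrak{j}_{N_T}}{\partial \mathbf{w}_{N_T}}\right)^T,$$ $$\boldsymbol\lambda_n-(L_{n,q})^T\boldsymbol\lambda_n=\boldsymbol\lambda_{n+1}+(R_{n,p})^T\boldsymbol\lambda_{n+1}-\left(\frac{\partial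 \mathfrak{j}_n}{\partial \mathbf{w}_n}\right)^T,\qquad n=N_T-1,\dots,1.$$ Then for every $k=1,\dots,N_P$ the exact derivative of the discrete cost function is $$\frac{d\mathcal{J}}{d\theta_k}=-\sum_{n=0}^{N_T-1}\left\langle \frac{\partial L_{n+1,q}}{\partial\theta_k}\mathbf{w}_{n+1}+\frac{\partial R_{n,p}}{\partial\theta_k}\mathbf{w}_n,\ \boldsymbol\lambda_{n+1}\right\rangle .$$
   Context: Setting. $N,N_P,N_T\ge 1$ are integers, $T>0$, $\Delta t=T/N_T$, $t_n=n\Delta t$ for $n=0,\dots,N_T$. Schrödinger's equation $\frac{d}{dt}\boldsymbol\psi=-iH(t;\boldsymbol\theta)\boldsymbol\psi$ on $\mathbb{C}^N$, with $H$ Hermitian, is written in real form with $\mathbf{w}=(\mathrm{Re}\,\boldsymbol\psi,\mathrm{Im}\,\boldsymbol\psi)\in\mathbb{R}^{2N}$ as $\frac{d}{dt}\mathbf{w}=A(t;\boldsymbol\theta)\mathbf{w}$, where $$A=\begin{bmatrix}S&K\\-K&S\end{bmatrix},\qquad K=\mathrm{Re}\,H\ (\text{symmetric}),\quad S=\mathrm{Im}\,H\ (\text{antisymmetric}).$$ Hermite Runge-Kutta matrices. Fix nonnegative integers $p,q$ with $p+q\ge 1$. Write $A_n^{(j)}=\frac{d^jA}{dt^j}(t_n;\boldsymbol\theta)$. Define $2N\times 2N$ matrices recursively by $$D_{n,0}=I,\qquad D_{n,j+1}=\sum_{i=0}^{j}\binom{j}{i}A_n^{(j-i)}D_{n,i},$$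 coefficients $$c_j^{pq}=\binom{p}{j}\Big/\binom{p+q}{j}$$ (so $c_j^{qp}=\binom{q}{j}/\binom{p+q}{j}$), and $$L_{n,q}=-\sum_{j=1}^{q}(-1)^jc_j^{qp}\frac{1}{j!}\Delta t^jD_{n,j},\qquad R_{n,p}=\sum_{j=1}^{p}c_j^{pq}\frac{1}{j!}\Delta t^jD_{n,j}.$$ Conventions. $\langle\cdot,\cdot\rangle$ is the Euclidean dot product. The partial derivative of a scalar with respect to a column vector is a row vector. $\partial L_{n,q}/\partial\theta_k$ and $\partial R_{n,p}/\partial\theta_k$ are entrywise derivatives of the matrices as functions of $\boldsymbol\theta$. It is assumed that $A$ is smooth enough in $t$ and $\boldsymbol\theta$ that all matrices above exist and are differentiable in $\boldsymbol\theta$, and that each $\mathbf{w}_n$ is a differentiable function of $\boldsymbol\theta$ satisfying the timestepping rule for all $\boldsymbol\theta$; the $\boldsymbol\lambda_n$ are taken at the value of $\boldsymbol\theta$ at which the derivative is computed. *)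

theory Defs
  imports "HOL-Analysis.Analysis"
begin

definition hermitian :: "complex^'n^'n \<Rightarrow> bool" where
  "hermitian M \<longleftrightarrow> (\<forall>i j. M $ i $ j = cnj (M $ j $ i))"

text \<open>With \<open>H = K + \<i> S\<close>, the block matrix \<open>[S, K; -K, S]\<close>. Vectors of length \<open>2N\<close> are indexed
  by the sum type: \<open>Inl\<close> for the real part, \<open>Inr\<close> for the imaginary part of the state.\<close>

definition real_form :: "complex^'n^'n \<Rightarrow> real^('n + 'n)^('n + 'n)" where
  "real_form H = (\<chi> a b. case a of
       Inl i \<Rightarrow> (case b of Inl j \<Rightarrow> Im (H $ i $ j) | Inr j \<Rightarrow> Re (H $ i $ j))
     | Inr i \<Rightarrow> (case b of Inl j \<Rightarrow> - Re (H $ i $ j) | Inr j \<Rightarrow> Im (H $ i $ j)))"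

definition time_point :: "real \<Rightarrow> nat \<Rightarrow> nat \<Rightarrow> real" where
  "time_point T N_T n = real n * (T / real N_T)"

text \<open>The \<open>j\<close>-th time derivative on the interval \<open>[0,T]\<close>, one-sided at the end points, so that
  nothing is required outside the interval.\<close>

definition time_deriv ::
  "real \<Rightarrow> nat \<Rightarrow> (real \<Rightarrow> 'a::real_normed_vector) \<Rightarrow> real \<Rightarrow> 'a" where
  "time_deriv T j f = ((\<lambda>g t. vector_derivative g (at t within {0..T})) ^^ j) f"

text \<open>In the next definitions \<open>B j\<close> stands for the \<open>j\<close>-th time derivative of \<open>A\<close> at a fixed
  time point and \<open>h\<close> for the time step.\<close>

fun hermite_D :: "(nat \<Rightarrow> real^'m^'m) \<Rightarrow> nat \<Rightarrow> real^'m^'m" where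
  "hermite_D B 0 = mat 1"
| "hermite_D B (Suc j) = (\<Sum>i\<le>j. real (j choose i) *\<^sub>R (B (j - i) ** hermite_D B i))"

definition hermite_coeff :: "nat \<Rightarrow> nat \<Rightarrow> nat \<Rightarrow> real" where
  "hermite_coeff p q j = real (p choose j) / real ((p + q) choose j)"

definition hermite_L :: "nat \<Rightarrow> nat \<Rightarrow> real \<Rightarrow> (nat \<Rightarrow> real^'m^'m) \<Rightarrow> real^'m^'m" where
  "hermite_L p q h B =
     - (\<Sum>j=1..q. ((-1) ^ j * hermite_coeff q p j * (1 / fact j) * h ^ j) *\<^sub>R hermite_D B j)"

definition hermite_R :: "nat \<Rightarrow> nat \<Rightarrow> real \<Rightarrow> (nat \<Rightarrow> real^'m^'m) \<Rightarrow> real^'m^'m" where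
  "hermite_R p q h B =
     (\<Sum>j=1..p. (hermite_coeff p q j * (1 / fact j) * h ^ j) *\<^sub>R hermite_D B j)"

definition hrk_L ::
  "(real \<Rightarrow> real^'k \<Rightarrow> real^'m^'m) \<Rightarrow> real \<Rightarrow> nat \<Rightarrow> nat \<Rightarrow> nat \<Rightarrow> nat \<Rightarrow> real^'k \<Rightarrow> real^'m^'m" where
  "hrk_L A T N_T p q n \<theta> =
     hermite_L p q (T / real N_T) (\<lambda>j. time_deriv T j (\<lambda>t. A t \<theta>) (time_point T N_T n))"

definition hrk_R ::
  "(real \<Rightarrow> real^'k \<Rightarrow> real^'m^'m) \<Rightarrow> real \<Rightarrow> nat \<Rightarrow> nat \<Rightarrow> nat \<Rightarrow> nat \<Rightarrow> real^'k \<Rightarrow> real^'m^'m" where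
  "hrk_R A T N_T p q n \<theta> =
     hermite_R p q (T / real N_T) (\<lambda>j. time_deriv T j (\<lambda>t. A t \<theta>) (time_point T N_T n))"

definition has_partial_deriv :: "(real^'k \<Rightarrow> real) \<Rightarrow> real \<Rightarrow> 'k \<Rightarrow> real^'k \<Rightarrow> bool" where
  "has_partial_deriv f d k x \<longleftrightarrow> ((\<lambda>s. f (x + s *\<^sub>R axis k 1)) has_real_derivative d) (at 0)"

definition partial_deriv :: "(real^'k \<Rightarrow> real) \<Rightarrow> 'k \<Rightarrow> real^'k \<Rightarrow> real" where
  "partial_deriv f k x = deriv (\<lambda>s. f (x + s *\<^sub>R axis k 1)) 0"

definition matrix_partial_deriv ::
  "(real^'k \<Rightarrow> real^'m^'l) \<Rightarrow> 'k \<Rightarrow> real^'k \<Rightarrow> real^'m^'l" where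
  "matrix_partial_deriv M k x = (\<chi> a b. partial_deriv (\<lambda>y. M y $ a $ b) k x)"

text \<open>The transposed (column) version of the row vector of partial derivatives.\<close>

definition gradient :: "(real^'m \<Rightarrow> real) \<Rightarrow> real^'m \<Rightarrow> real^'m" where
  "gradient f x = (\<chi> i. partial_deriv f i x)"

end

theory Submission
  imports Defs
begin

text \<open>Differentiating the scheme in \<open>\<theta>\<^sub>k\<close> gives the same linear recursion for the sensitivities
  \<open>\<partial>w\<^sub>n/\<partial>\<theta>\<^sub>k\<close>, driven by \<open>(\<partial>L\<^sub>n\<^sub>+\<^sub>1/\<partial>\<theta>\<^sub>k) w\<^sub>n\<^sub>+\<^sub>1 + (\<partial>R\<^sub>n/\<partial>\<theta>\<^sub>k) w\<^sub>n\<close> and started at zero. Pairing it with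
  \<open>\<lambda>\<^sub>n\<^sub>+\<^sub>1\<close>, moving the matrices to the other side by transposition and summing by parts, the adjoint
  equations leave exactly the terms \<open>\<langle>\<nabla>j\<^sub>n, \<partial>w\<^sub>n/\<partial>\<theta>\<^sub>k\<rangle>\<close> of the chain rule.\<close>

lemma inner_transpose_matrix_vector_mult:
  fixes M :: "real^'m^'l"
  shows "x \<bullet> (transpose M *v y) = (M *v x) \<bullet> y"
  by (metis dot_lmul_matrix inner_commute vector_transpose_matrix)

text \<open>In finite dimension bilinearity already forces boundedness, so checking linearity in
  each factor suffices. The purpose is to make the product rule available.\<close>

lemma bounded_bilinear_matrix_matrix_mult:
  "bounded_bilinear ((**) :: real^'m^'l \<Rightarrow> real^'n^'m \<Rightarrow> real^'n^'l)"
  unfolding bilinear_conv_bounded_bilinear[symmetric] bilinear_def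
  by (auto intro!: linearI simp: vec_eq_iff matrix_matrix_mult_def algebra_simps sum.distrib
      sum_distrib_left)

lemma bounded_bilinear_matrix_vector_mult:
  "bounded_bilinear ((*v) :: real^'m^'l \<Rightarrow> real^'m \<Rightarrow> real^'l)"
  unfolding bilinear_conv_bounded_bilinear[symmetric] bilinear_def
  by (auto intro!: linearI simp: vec_eq_iff matrix_vector_mult_def algebra_simps sum.distrib
      sum_distrib_left)

lemma differentiable_matrix_matrix_mult:
  fixes f :: "'a::real_normed_vector \<Rightarrow> real^'m^'l" and g :: "'a \<Rightarrow> real^'n^'m"
  assumes "f differentiable (at x within S)" and "g differentiable (at x within S)"
  shows "(\<lambda>y. f y ** g y) differentiable (at x within S)"
  using assms unfolding differentiable_def
  by (blast intro: bounded_bilinear.FDERIV[OF bounded_bilinear_matrix_matrix_mult])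

text \<open>The recursion for index \<open>Suc m\<close> refers to all indices up to
  \<open>m\<close>, hence strong induction. It involves only \<open>B 0\<close>, ...,
  \<open>B m\<close>, which explains the bound \<open>i < j\<close>.\<close>

lemma differentiable_hermite_D:
  fixes B :: "'a::real_normed_vector \<Rightarrow> nat \<Rightarrow> real^'m^'m"
  assumes "\<And>i. i < j \<Longrightarrow> (\<lambda>y. B y i) differentiable (at x within S)"
  shows "(\<lambda>y. hermite_D (B y) j) differentiable (at x within S)"
  using assms
proof (induction j rule: less_induct)
  case (less j)
  show ?case
  proof (cases j)
    case (Suc m)
    have "(\<lambda>y. B y (m - i) ** hermite_D (B y) i) differentiable (at x within S)" if "i \<le> m" for i
      using that Suc by (intro differentiable_matrix_matrix_mult less.IH less.prems) auto
    then show ?thesis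
      unfolding Suc hermite_D.simps by (intro differentiable_sum differentiable_scaleR) auto
  qed simp
qed

lemma differentiable_hermite_L:
  fixes B :: "'a::real_normed_vector \<Rightarrow> nat \<Rightarrow> real^'m^'m"
  assumes "\<And>i. i < q \<Longrightarrow> (\<lambda>y. B y i) differentiable (at x within S)"
  shows "(\<lambda>y. hermite_L p q h (B y)) differentiable (at x within S)"
  unfolding hermite_L_def using assms
  by (intro differentiable_minus differentiable_sum differentiable_scaleR
      differentiable_hermite_D ballI) auto

lemma differentiable_hermite_R:
  fixes B :: "'a::real_normed_vector \<Rightarrow> nat \<Rightarrow> real^'m^'m"
  assumes "\<And>i. i < p \<Longrightarrow> (\<lambda>y. B y i) differentiable (at x within S)"
  shows "(\<lambda>y. hermite_R p q h (B y)) differentiable (at x within S)"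
  unfolding hermite_R_def using assms
  by (intro differentiable_sum differentiable_scaleR differentiable_hermite_D ballI) auto

text \<open>Chain rule with an affine inner map. It reduces derivatives in \<theta> to derivatives
  of curves in one real variable, the form in which \<open>partial_deriv\<close> is defined.\<close>

lemma has_derivative_imp_has_vector_derivative_line:
  assumes "(f has_derivative f') (at x)"
  shows "((\<lambda>s. f (x + s *\<^sub>R v)) has_vector_derivative f' v) (at 0)"
proof -
  have "((\<lambda>s. x + s *\<^sub>R v) has_derivative (\<lambda>s. s *\<^sub>R v)) (at 0)"
    by (auto intro!: derivative_eq_intros)
  moreover have "(f has_derivative f') (at (x + 0 *\<^sub>R v))"
    using assms by simp
  ultimately have "((\<lambda>s. f (x + s *\<^sub>R v)) has_derivative (\<lambda>s. f' (s *\<^sub>R v))) (at 0)"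
    by (rule has_derivative_compose)
  then show ?thesis
    using linear_scale[OF has_derivative_linear[OF assms]]
    by (simp add: has_vector_derivative_def)
qed

lemma differentiable_imp_has_vector_derivative_line:
  assumes "f differentiable (at x)"
  obtains d where "((\<lambda>s. f (x + s *\<^sub>R v)) has_vector_derivative d) (at 0)"
  using assms has_derivative_imp_has_vector_derivative_line unfolding differentiable_def by blast

lemma has_derivative_imp_partial_deriv:
  assumes "(f has_derivative f') (at x)"
  shows "partial_deriv f k x = f' (axis k 1)"
  using has_derivative_imp_has_vector_derivative_line[OF assms, of "axis k 1"]
  by (simp add: partial_deriv_def DERIV_imp_deriv has_real_derivative_iff_has_vector_derivative)

text \<open>By linearity \<open>f'\<close> is determined by its values on the standard basis, and
  these values are the partial derivatives.\<close>

lemma has_derivative_eq_inner_gradient: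
  fixes f :: "real^'m \<Rightarrow> real"
  assumes "(f has_derivative f') (at x)"
  shows "f' v = gradient f x \<bullet> v"
proof -
  have lin: "linear f'"
    using assms by (rule has_derivative_linear)
  have "f' v = f' (\<Sum>i\<in>UNIV. (v $ i) *\<^sub>R axis i 1)"
    by (simp add: basis_expansion flip: scalar_mult_eq_scaleR)
  also have "\<dots> = (\<Sum>i\<in>UNIV. v $ i * f' (axis i 1))"
    by (simp add: linear_sum[OF lin] linear_scale[OF lin])
  also have "\<dots> = gradient f x \<bullet> v"
    by (simp add: inner_vec_def gradient_def has_derivative_imp_partial_deriv[OF assms] mult.commute)
  finally show ?thesis .
qed

text \<open>The entrywise \<open>deriv\<close> values are genuine derivatives here: each entry is a
  bounded linear function of the matrix, so it inherits differentiability.\<close>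

lemma differentiable_imp_has_vector_derivative_matrix_partial_deriv:
  fixes M :: "real^'k \<Rightarrow> real^'m^'l"
  assumes "M differentiable (at x)"
  shows "((\<lambda>s. M (x + s *\<^sub>R axis k 1)) has_vector_derivative matrix_partial_deriv M k x) (at 0)"
proof -
  obtain M' where M': "(M has_derivative M') (at x)"
    using assms unfolding differentiable_def by blast
  have "((\<lambda>y. M y $ a $ b) has_derivative (\<lambda>v. M' v $ a $ b)) (at x)" for a b
    by (intro bounded_linear.has_derivative[OF bounded_linear_vec_nth] M')
  from has_derivative_imp_partial_deriv[OF this]
  have "matrix_partial_deriv M k x = M' (axis k 1)"
    by (simp add: matrix_partial_deriv_def vec_eq_iff)
  then show ?thesis
    using has_derivative_imp_has_vector_derivative_line[OF M', of "axis k 1"] by simp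
qed

lemma has_real_derivative_comp_gradient:
  fixes f :: "real^'m \<Rightarrow> real"
  assumes "f differentiable (at (u t))" and "(u has_vector_derivative d) (at t)"
  shows "((\<lambda>s. f (u s)) has_real_derivative gradient f (u t) \<bullet> d) (at t)"
proof -
  obtain f' where f': "(f has_derivative f') (at (u t))"
    using assms(1) unfolding differentiable_def by blast
  have "((\<lambda>s. f (u s)) has_derivative (\<lambda>s. f' (s *\<^sub>R d))) (at t)"
    using assms(2) f' unfolding has_vector_derivative_def by (rule has_derivative_compose)
  then show ?thesis
    unfolding has_real_derivative_iff_has_vector_derivative has_vector_derivative_def
      has_derivative_eq_inner_gradient[OF f'] by (simp add: has_vector_derivative_def)
qed

text \<open>This is the purely algebraic core: \<open>v\<close> plays the sensitivities,
  \<open>F\<close> their forcing and \<open>g\<close> the cost gradients; no derivative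
  occurs.\<close>

lemma discrete_adjoint_identity:
  fixes L R :: "nat \<Rightarrow> real^'m^'m" and v F g lam :: "nat \<Rightarrow> real^'m"
  assumes "N \<ge> 1" and "v 0 = 0"
    and step: "\<And>n. n < N \<Longrightarrow>
      v (Suc n) - L (Suc n) *v v (Suc n) = v n + R n *v v n + F n"
    and terminal: "lam N - transpose (L N) *v lam N = - g N"
    and adjoint: "\<And>n. 1 \<le> n \<Longrightarrow> n < N \<Longrightarrow>
      lam n - transpose (L n) *v lam n = lam (Suc n) + transpose (R n) *v lam (Suc n) - g n"
  shows "(\<Sum>n\<le>N. g n \<bullet> v n) = - (\<Sum>n<N. F n \<bullet> lam (Suc n))"
proof -
  \<comment> \<open>Summation by parts up to \<open>m\<close> leaves one boundary term. The
    induction starts at 1 because the adjoint equations begin there.\<close>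
  have "(\<Sum>n<m. F n \<bullet> lam (Suc n))
      = v m \<bullet> (lam m - transpose (L m) *v lam m) - (\<Sum>n<m. g n \<bullet> v n)"
    if "1 \<le> m" "m \<le> N" for m
    using that
  proof (induction m rule: dec_induct)
    case base
    have "F 0 = v 1 - L 1 *v v 1"
      using step[of 0] \<open>N \<ge> 1\<close> \<open>v 0 = 0\<close> by simp
    then show ?case
      using \<open>v 0 = 0\<close>
      by (simp add: inner_diff_left inner_diff_right inner_transpose_matrix_vector_mult
          del: transpose_matrix_vector)
  next
    case (step m)
    have F: "F m = v (Suc m) - L (Suc m) *v v (Suc m) - (v m + R m *v v m)"
      using assms(3)[of m] step by (simp add: algebra_simps)
    have lam: "lam m - transpose (L m) *v lam m
        = lam (Suc m) + transpose (R m) *v lam (Suc m) - g m"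
      using step adjoint by simp
    have IH: "(\<Sum>n<m. F n \<bullet> lam (Suc n))
        = v m \<bullet> (lam m - transpose (L m) *v lam m) - (\<Sum>n<m. g n \<bullet> v n)"
      using step by simp
    \<comment> \<open>Pairing \<open>F m\<close> with \<open>lam (Suc m)\<close> creates the new
      boundary term and, after transposing \<open>R m\<close>, cancels the old one up to
      \<open>- g m \<bullet> v m\<close>.\<close>
    show ?case
      unfolding sum.lessThan_Suc IH lam F
      by (simp add: inner_diff_left inner_diff_right inner_add_left inner_add_right
          inner_transpose_matrix_vector_mult inner_commute del: transpose_matrix_vector)
  qed
  \<comment> \<open>At \<open>m = N\<close> the terminal condition turns the boundary term into
    \<open>- g N \<bullet> v N\<close>, the missing last summand.\<close>
  from this[of N] show ?thesis
    using \<open>N \<ge> 1\<close> terminal by (simp add: inner_commute flip: lessThan_Suc_atMost)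
qed

theorem theorem1:
  fixes H :: "real \<Rightarrow> real^'k \<Rightarrow> complex^'n^'n"
    and A :: "real \<Rightarrow> real^'k \<Rightarrow> real^('n + 'n)^('n + 'n)"
    and T :: real and N_T p q :: nat
    and w :: "nat \<Rightarrow> real^'k \<Rightarrow> real^('n + 'n)" and w0 :: "real^('n + 'n)"
    and \<jj> :: "nat \<Rightarrow> real^('n + 'n) \<Rightarrow> real"
    and lam :: "nat \<Rightarrow> real^('n + 'n)"
    and \<theta> :: "real^'k" and k :: 'k
  assumes T_pos: "T > 0" and N_T_pos: "N_T \<ge> 1" and pq: "p + q \<ge> 1"
    and H_hermitian: "\<And>t \<eta>. t \<in> {0..T} \<Longrightarrow> hermitian (H t \<eta>)"
    and A_eq: "\<And>t \<eta>. A t \<eta> = real_form (H t \<eta>)"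
    and A_smooth_time:
      "\<And>j t \<eta>. Suc j < max p q \<Longrightarrow> t \<in> {0..T} \<Longrightarrow>
         time_deriv T j (\<lambda>s. A s \<eta>) differentiable (at t within {0..T})"
    and A_smooth_control:
      "\<And>j n \<eta>. j < max p q \<Longrightarrow> n \<le> N_T \<Longrightarrow>
         (\<lambda>\<zeta>. time_deriv T j (\<lambda>s. A s \<zeta>) (time_point T N_T n)) differentiable (at \<eta>)"
    and w_differentiable: "\<And>n \<eta>. n \<le> N_T \<Longrightarrow> w n differentiable (at \<eta>)"
    and w_initial: "\<And>\<eta>. w 0 \<eta> = w0"
    and w_step:
      "\<And>n \<eta>. n < N_T \<Longrightarrow>
         w (n + 1) \<eta> - hrk_L A T N_T p q (n + 1) \<eta> *v w (n + 1) \<eta>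
           = w n \<eta> + hrk_R A T N_T p q n \<eta> *v w n \<eta>"
    and j_differentiable: "\<And>n x. n \<le> N_T \<Longrightarrow> \<jj> n differentiable (at x)"
    and adjoint_terminal:
      "lam N_T - transpose (hrk_L A T N_T p q N_T \<theta>) *v lam N_T
         = - gradient (\<jj> N_T) (w N_T \<theta>)"
    and adjoint_step:
      "\<And>n. 1 \<le> n \<Longrightarrow> n < N_T \<Longrightarrow>
         lam n - transpose (hrk_L A T N_T p q n \<theta>) *v lam n
           = lam (n + 1) + transpose (hrk_R A T N_T p q n \<theta>) *v lam (n + 1)
             - gradient (\<jj> n) (w n \<theta>)"
  shows "has_partial_deriv (\<lambda>\<eta>. \<Sum>n\<le>N_T. \<jj> n (w n \<eta>))
           (- (\<Sum>n<N_T.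
                 (matrix_partial_deriv (hrk_L A T N_T p q (n + 1)) k \<theta> *v w (n + 1) \<theta>
                  + matrix_partial_deriv (hrk_R A T N_T p q n) k \<theta> *v w n \<theta>)
                 \<bullet> lam (n + 1)))
           k \<theta>"
proof -
  define e :: "real^'k" where "e = axis k 1"
  define L where "L n = hrk_L A T N_T p q n" for n
  define R where "R n = hrk_R A T N_T p q n" for n
  define F where "F n = matrix_partial_deriv (L (n + 1)) k \<theta> *v w (n + 1) \<theta>
    + matrix_partial_deriv (R n) k \<theta> *v w n \<theta>" for n
  have L_deriv: "((\<lambda>s. L n (\<theta> + s *\<^sub>R e)) has_vector_derivative matrix_partial_deriv (L n) k \<theta>) (at 0)"
    and R_deriv: "((\<lambda>s. R n (\<theta> + s *\<^sub>R e)) has_vector_derivative matrix_partial_deriv (R n) k \<theta>) (at 0)"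
    if "n \<le> N_T" for n
  proof -
    \<comment> \<open>\<open>L n\<close> uses time derivatives of order below \<open>q\<close> and
      \<open>R n\<close> those of order below \<open>p\<close>; both lie below
      \<open>max p q\<close>.\<close>
    have "L n differentiable (at \<theta>)"
      unfolding L_def hrk_L_def by (intro differentiable_hermite_L A_smooth_control that) simp
    moreover have "R n differentiable (at \<theta>)"
      unfolding R_def hrk_R_def by (intro differentiable_hermite_R A_smooth_control that) simp
    ultimately show
      "((\<lambda>s. L n (\<theta> + s *\<^sub>R e)) has_vector_derivative matrix_partial_deriv (L n) k \<theta>) (at 0)"
      "((\<lambda>s. R n (\<theta> + s *\<^sub>R e)) has_vector_derivative matrix_partial_deriv (R n) k \<theta>) (at 0)"
      unfolding e_def by (simp_all add: differentiable_imp_has_vector_derivative_matrix_partial_deriv)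
  qed
  have "\<exists>d. ((\<lambda>s. w n (\<theta> + s *\<^sub>R e)) has_vector_derivative d) (at 0)" if "n \<le> N_T" for n
    using differentiable_imp_has_vector_derivative_line[OF w_differentiable[OF that]] by metis
  then obtain v where v:
    "((\<lambda>s. w n (\<theta> + s *\<^sub>R e)) has_vector_derivative v n) (at 0)" if "n \<le> N_T" for n
    by metis
  \<comment> \<open>The initial state is the same for every control, so its curve is
    constant.\<close>
  have v0: "v 0 = 0"
    using vector_derivative_unique_at[OF v[of 0, unfolded w_initial] has_vector_derivative_const]
    by simp
  have v_step: "v (Suc n) - L (Suc n) \<theta> *v v (Suc n) = v n + R n \<theta> *v v n + F n"
    if n: "n < N_T" for n
  proof -
    note mult = bounded_bilinear.has_vector_derivative[OF bounded_bilinear_matrix_vector_mult]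
    \<comment> \<open>The terms \<open>0 *\<^sub>R e\<close> are kept because the product rule
      evaluates the factors of the curve at \<open>s = 0\<close>.\<close>
    have lhs: "((\<lambda>s. w (Suc n) (\<theta> + s *\<^sub>R e) - L (Suc n) (\<theta> + s *\<^sub>R e) *v w (Suc n) (\<theta> + s *\<^sub>R e))
        has_vector_derivative v (Suc n) - (L (Suc n) (\<theta> + 0 *\<^sub>R e) *v v (Suc n)
          + matrix_partial_deriv (L (Suc n)) k \<theta> *v w (Suc n) (\<theta> + 0 *\<^sub>R e))) (at 0)"
      using n by (intro has_vector_derivative_diff mult v L_deriv) auto
    have rhs: "((\<lambda>s. w n (\<theta> + s *\<^sub>R e) + R n (\<theta> + s *\<^sub>R e) *v w n (\<theta> + s *\<^sub>R e))
        has_vector_derivative v n + (R n (\<theta> + 0 *\<^sub>R e) *v v n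
          + matrix_partial_deriv (R n) k \<theta> *v w n (\<theta> + 0 *\<^sub>R e))) (at 0)"
      using n by (intro has_vector_derivative_add mult v R_deriv) auto
    \<comment> \<open>Since the scheme holds at every control, both sides are the same function of
      \<open>s\<close>, and uniqueness of the derivative equates the two expressions.\<close>
    have "w (Suc n) \<eta> - L (Suc n) \<eta> *v w (Suc n) \<eta> = w n \<eta> + R n \<eta> *v w n \<eta>" for \<eta>
      using w_step[OF n, of \<eta>] by (simp add: L_def R_def)
    with vector_derivative_unique_at[OF lhs] rhs
    have "v (Suc n) - (L (Suc n) (\<theta> + 0 *\<^sub>R e) *v v (Suc n)
          + matrix_partial_deriv (L (Suc n)) k \<theta> *v w (Suc n) (\<theta> + 0 *\<^sub>R e))
        = v n + (R n (\<theta> + 0 *\<^sub>R e) *v v n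
          + matrix_partial_deriv (R n) k \<theta> *v w n (\<theta> + 0 *\<^sub>R e))"
      by simp
    then show ?thesis
      by (simp add: F_def algebra_simps)
  qed
  have "((\<lambda>s. \<Sum>n\<le>N_T. \<jj> n (w n (\<theta> + s *\<^sub>R e))) has_real_derivative
      (\<Sum>n\<le>N_T. gradient (\<jj> n) (w n (\<theta> + 0 *\<^sub>R e)) \<bullet> v n)) (at 0)"
    by (intro DERIV_sum has_real_derivative_comp_gradient j_differentiable v) auto
  \<comment> \<open>The adjoint identity trades the sensitivities \<open>v n\<close> for the
    multipliers \<open>lam\<close>, which do not depend on the direction \<open>k\<close>.\<close>
  also have "(\<Sum>n\<le>N_T. gradient (\<jj> n) (w n (\<theta> + 0 *\<^sub>R e)) \<bullet> v n)
      = - (\<Sum>n<N_T. F n \<bullet> lam (Suc n))"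
    using adjoint_terminal adjoint_step
    by (intro discrete_adjoint_identity[OF N_T_pos v0 v_step]) (auto simp: L_def R_def)
  finally show ?thesis
    by (simp add: has_partial_deriv_def F_def L_def R_def e_def)
qed

end
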